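(* Let $N,k,k'$ be positive integers with $kk'=N$ and let $i$ be an integer with $0\le i<k$. Let $T=\mathbb{R}^2/\mathbb{Z}^2$, and let $T_{N;k,i}=\mathbb{R}^2/\Gamma_{N;k,i}$, where $\Gamma_{N;k,i}\subset\mathbb{Z}^2$ is the sublattice of index $N$ generated by $x_1=(k,0)$ and $x_2=(i,k')$. Let $\mathcal{C}$ and $\mathcal{C}'$ be closed curves on $T_{N;k,i}$ with homology classes $(p,q)$ and $(p',q')$, respectively, with respect to the cycles $x_1,x_2$ of $T_{N;k,i}$. Then, with respect to the standard cycles $y_1=(1,0)$, $y_2=(0,1)$ of $T$, the images of $\mathcal{C}$ and $\mathcal{C}'$ in $T$ have homology classes $(e,m)=(pk+qi,\,qk')$ and $(e',m')=(p'k+q'i,\,q'k')$, and their intersection number in $T$ is $$\#(\mathcal{C},\mathcal{C}')=em'-me'=(pq'-qp')\,N.$$ In particular, $em'-me'\equiv 0 \pmod N$.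
   Context: Since $\Gamma_{N;k,i}\subset\mathbb{Z}^2$ has index $N$, the quotient map $T_{N;k,i}\to T$ is an $N$-fold covering; curves on $T_{N;k,i}$ are mapped to $T$ via this covering. The homology class $(p,q)$ with respect to the cycles $x_1,x_2$ means $p[x_1]+q[x_2]\in H_1(T_{N;k,i};\mathbb{Z})$, and similarly for $(e,m)$ with respect to $y_1,y_2$ in $H_1(T;\mathbb{Z})$. The intersection number is the algebraic intersection number on $T$, i.e. the value of the symplectic form with matrix $\begin{pmatrix}0&1\\-1&0\end{pmatrix}$ in the basis $y_1,y_2$ of $H_1(T;\mathbb{Z})$. *)

theory Defs
  imports "HOL-Homology.Homology" "HOL-Number_Theory.Cong"
begin

section \<open>Plane tori\<close>

definition plane_lattice :: "real \<times> real \<Rightarrow> real \<times> real \<Rightarrow> (real \<times> real) set" where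
  "plane_lattice u v = {of_int a *\<^sub>R u + of_int b *\<^sub>R v | a b :: int. True}"

definition plane_coset :: "(real \<times> real) set \<Rightarrow> real \<times> real \<Rightarrow> (real \<times> real) set" where
  "plane_coset \<Gamma> x = (\<lambda>g. x + g) ` \<Gamma>"

definition torus :: "(real \<times> real) set \<Rightarrow> (real \<times> real) set topology" where
  "torus \<Gamma> = topology (\<lambda>U. U \<subseteq> range (plane_coset \<Gamma>) \<and> open {x. plane_coset \<Gamma> x \<in> U})"

definition std_torus :: "(real \<times> real) set topology" where
  "std_torus = torus (\<int> \<times> \<int>)"

text \<open>For \<open>\<Gamma> \<subseteq> \<int> \<times> \<int>\<close> this sends \<open>x + \<Gamma>\<close> to \<open>x + \<int> \<times> \<int>\<close>; see
  \<open>covering_proj_plane_coset\<close> below.\<close>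

definition covering_proj :: "(real \<times> real) set \<Rightarrow> (real \<times> real) set" where
  "covering_proj c = {x + z | x z. x \<in> c \<and> z \<in> \<int> \<times> \<int>}"

lemma istopology_torus:
  "istopology (\<lambda>U. U \<subseteq> range (plane_coset \<Gamma>) \<and> open {x. plane_coset \<Gamma> x \<in> U})"
proof -
  have "open {x. plane_coset \<Gamma> x \<in> S \<inter> T}"
    if "open {x. plane_coset \<Gamma> x \<in> S}" "open {x. plane_coset \<Gamma> x \<in> T}" for S T
    using open_Int[OF that] by (simp add: Collect_conj_eq)
  moreover have "open {x. plane_coset \<Gamma> x \<in> \<Union>\<K>}"
    if "\<forall>K\<in>\<K>. open {x. plane_coset \<Gamma> x \<in> K}" for \<K>
  proof -
    have "{x. plane_coset \<Gamma> x \<in> \<Union>\<K>} = (\<Union>K\<in>\<K>. {x. plane_coset \<Gamma> x \<in> K})" by blast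
    then show ?thesis using that by auto
  qed
  ultimately show ?thesis
    unfolding istopology_def by blast
qed

lemma openin_torus:
  "openin (torus \<Gamma>) U \<longleftrightarrow> U \<subseteq> range (plane_coset \<Gamma>) \<and> open {x. plane_coset \<Gamma> x \<in> U}"
  by (simp add: torus_def istopology_torus topology_inverse')

lemma topspace_torus: "topspace (torus \<Gamma>) = range (plane_coset \<Gamma>)"
proof -
  have "openin (torus \<Gamma>) (range (plane_coset \<Gamma>))" by (simp add: openin_torus)
  then show ?thesis
    using openin_subset openin_topspace openin_torus by (metis subset_antisym)
qed

lemma quotient_map_plane_coset: "quotient_map euclidean (torus \<Gamma>) (plane_coset \<Gamma>)"
  by (simp add: quotient_map_def topspace_torus openin_torus)

lemma covering_proj_plane_coset:
  assumes "\<Gamma> \<subseteq> \<int> \<times> \<int>" and "0 \<in> \<Gamma>"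
  shows "covering_proj (plane_coset \<Gamma> x) = plane_coset (\<int> \<times> \<int>) x"
proof (rule Set.set_eqI)
  have Z_add: "v + w \<in> \<int> \<times> \<int>" if "v \<in> \<int> \<times> \<int>" "w \<in> \<int> \<times> \<int>" for v w :: "real \<times> real"
    using that by (auto simp: mem_Times_iff)
  fix y
  show "y \<in> covering_proj (plane_coset \<Gamma> x) \<longleftrightarrow> y \<in> plane_coset (\<int> \<times> \<int>) x"
  proof
    assume "y \<in> covering_proj (plane_coset \<Gamma> x)"
    then obtain g z where "g \<in> \<Gamma>" and z: "z \<in> \<int> \<times> \<int>" and y: "y = x + g + z"
      unfolding covering_proj_def plane_coset_def by blast
    then have "g + z \<in> \<int> \<times> \<int>" using assms(1) by (intro Z_add) auto
    then show "y \<in> plane_coset (\<int> \<times> \<int>) x"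
      unfolding plane_coset_def by (rule rev_image_eqI) (simp add: y add.assoc)
  next
    assume "y \<in> plane_coset (\<int> \<times> \<int>) x"
    then obtain z where "z \<in> \<int> \<times> \<int>" and "y = x + z"
      unfolding plane_coset_def by blast
    moreover have "x \<in> plane_coset \<Gamma> x"
      unfolding plane_coset_def using assms(2) by (rule rev_image_eqI) simp
    ultimately show "y \<in> covering_proj (plane_coset \<Gamma> x)"
      unfolding covering_proj_def by blast
  qed
qed

lemma zero_in_lattice: "0 \<in> plane_lattice u v"
  unfolding plane_lattice_def by (intro CollectI exI[of _ 0]) simp

lemma lattice_subset_Ints:
  "plane_lattice (of_int k, 0) (of_int i, of_int k') \<subseteq> \<int> \<times> \<int>"
  by (auto simp: plane_lattice_def)

lemma plane_coset_lattice_eqI: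
  assumes "x = y + (of_int a *\<^sub>R u + of_int b *\<^sub>R v)"
  shows "plane_coset (plane_lattice u v) x = plane_coset (plane_lattice u v) y"
proof (rule Set.set_eqI)
  fix z
  have 1: "y + (of_int a *\<^sub>R u + of_int b *\<^sub>R v) + (of_int c *\<^sub>R u + of_int d *\<^sub>R v) =
      y + (of_int (a + c) *\<^sub>R u + of_int (b + d) *\<^sub>R v)" for c d
    by (simp add: algebra_simps)
  have 2: "y + (of_int c *\<^sub>R u + of_int d *\<^sub>R v) =
      x + (of_int (c - a) *\<^sub>R u + of_int (d - b) *\<^sub>R v)" for c d
    by (simp add: assms algebra_simps)
  show "z \<in> plane_coset (plane_lattice u v) x \<longleftrightarrow> z \<in> plane_coset (plane_lattice u v) y"
    unfolding plane_coset_def plane_lattice_def image_iff mem_Collect_eq Bex_def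
    using 1 2 assms by metis
qed

lemma index_lattice:
  fixes k k' i :: int
  assumes "k > 0" "k' > 0"
  defines "\<Gamma> \<equiv> plane_lattice (of_int k, 0) (of_int i, of_int k')"
  shows "card (plane_coset \<Gamma> ` (\<int> \<times> \<int>)) = nat (k * k')"
proof -
  define f where "f = (\<lambda>(a::int, b::int). plane_coset \<Gamma> (of_int a, of_int b))"
  have inj: "inj_on f ({0..<k} \<times> {0..<k'})"
  proof (rule inj_onI, clarsimp)
    fix a b c d
    assume r: "0 \<le> a" "a < k" "0 \<le> b" "b < k'" "0 \<le> c" "c < k" "0 \<le> d" "d < k'"
      and eq: "f (a, b) = f (c, d)"
    have "(of_int a, of_int b) \<in> f (a, b)"
      unfolding f_def plane_coset_def \<Gamma>_def prod.case
      by (rule rev_image_eqI[OF zero_in_lattice]) simp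
    then obtain s t :: int
      where "(real_of_int a, real_of_int b) =
        (of_int c, of_int d) + (of_int s *\<^sub>R (of_int k, 0) + of_int t *\<^sub>R (of_int i, of_int k'))"
      unfolding eq unfolding f_def plane_coset_def \<Gamma>_def plane_lattice_def by blast
    then have "real_of_int a = of_int (c + s * k + t * i)" and "real_of_int b = of_int (d + t * k')"
      by simp_all
    then have ab: "a = c + s * k + t * i" "b = d + t * k'"
      by (simp_all only: of_int_eq_iff)
    then have "b mod k' = d mod k'" by simp
    then have "b = d" using r by simp
    then have "t = 0" using ab assms by simp
    then have "a mod k = c mod k" using ab by simp
    then show "a = c \<and> b = d" using r \<open>b = d\<close> by simp
  qed
  have "plane_coset \<Gamma> ` (\<int> \<times> \<int>) = f ` ({0..<k} \<times> {0..<k'})"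
  proof (intro equalityI subsetI)
    fix z assume "z \<in> plane_coset \<Gamma> ` (\<int> \<times> \<int>)"
    then obtain a b where z: "z = f (a, b)" by (auto simp: f_def elim!: Ints_cases)
    define t where "t = b div k'"
    define s where "s = (a - t * i) div k"
    have a: "a = (a - t * i) mod k + s * k + t * i"
      using div_mult_mod_eq[of "a - t * i" k] unfolding s_def by linarith
    have b: "b = b mod k' + t * k'" by (simp add: t_def)
    have "(real_of_int a, real_of_int b) = (of_int ((a - t * i) mod k), of_int (b mod k')) +
        (of_int s *\<^sub>R (of_int k, 0) + of_int t *\<^sub>R (of_int i, of_int k'))"
      using arg_cong[OF a, of real_of_int] arg_cong[OF b, of real_of_int] by simp
    then have "z = f ((a - t * i) mod k, b mod k')"
      unfolding z f_def \<Gamma>_def prod.case by (rule plane_coset_lattice_eqI)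
    then show "z \<in> f ` ({0..<k} \<times> {0..<k'})" using assms by simp
  next
    fix z assume "z \<in> f ` ({0..<k} \<times> {0..<k'})"
    then show "z \<in> plane_coset \<Gamma> ` (\<int> \<times> \<int>)" by (auto simp: f_def)
  qed
  then show ?thesis
    using inj assms by (simp add: card_image card_cartesian_product nat_mult_distrib)
qed

section \<open>Closed curves and their homology classes\<close>

definition closed_curve :: "'a topology \<Rightarrow> (real \<Rightarrow> 'a) \<Rightarrow> bool" where
  "closed_curve X c \<longleftrightarrow> pathin X c \<and> c 0 = c 1"

text \<open>A curve is read as a singular 1-simplex through the barycentric coordinate \<open>x 1\<close>, so
  that it runs from vertex 0 to vertex 1.\<close>

definition curve_simplex :: "(real \<Rightarrow> 'a) \<Rightarrow> (nat \<Rightarrow> real) \<Rightarrow> 'a" where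
  "curve_simplex c = (\<lambda>x \<in> standard_simplex 1. c (x 1))"

definition curve_class :: "'a topology \<Rightarrow> (real \<Rightarrow> 'a) \<Rightarrow> 'a chain set" where
  "curve_class X c = homologous_rel_set 1 X {} (frag_of (curve_simplex c))"

definition torus_cycle :: "(real \<times> real) set \<Rightarrow> real \<times> real \<Rightarrow> real \<Rightarrow> (real \<times> real) set" where
  "torus_cycle \<Gamma> v = (\<lambda>t. plane_coset \<Gamma> (t *\<^sub>R v))"

text \<open>\<open>int_combination X a b p q\<close> is the class \<open>p [a] + q [b]\<close>; the homology groups of
  the library are written multiplicatively.\<close>

definition int_combination ::
  "'a topology \<Rightarrow> (real \<Rightarrow> 'a) \<Rightarrow> (real \<Rightarrow> 'a) \<Rightarrow> int \<Rightarrow> int \<Rightarrow> 'a chain set" where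
  "int_combination X a b p q =
     curve_class X a [^]\<^bsub>homology_group 1 X\<^esub> p \<otimes>\<^bsub>homology_group 1 X\<^esub>
     curve_class X b [^]\<^bsub>homology_group 1 X\<^esub> q"

definition has_homology_class ::
  "'a topology \<Rightarrow> (real \<Rightarrow> 'a) \<Rightarrow> (real \<Rightarrow> 'a) \<Rightarrow> (real \<Rightarrow> 'a) \<Rightarrow> int \<Rightarrow> int \<Rightarrow> bool" where
  "has_homology_class X a b c p q \<longleftrightarrow> curve_class X c = int_combination X a b p q"

lemma singular_simplex_curve:
  assumes "pathin X c"
  shows "singular_simplex 1 X (curve_simplex c)"
proof -
  have "continuous_map (powertop_real UNIV) euclideanreal (\<lambda>x. x (1::nat))"
    by (rule continuous_map_product_projection) simp
  then have "continuous_map (subtopology (powertop_real UNIV) (standard_simplex 1))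
      (top_of_set {0..1}) (\<lambda>x. x 1)"
    by (auto simp: continuous_map_in_subtopology continuous_map_from_subtopology
        standard_simplex_def)
  then have "continuous_map (subtopology (powertop_real UNIV) (standard_simplex 1)) X
      (c \<circ> (\<lambda>x. x 1))"
    using assms continuous_map_compose unfolding pathin_def by blast
  then show ?thesis
    unfolding singular_simplex_def curve_simplex_def
    by (auto elim: continuous_map_eq)
qed

lemma singular_relcycle_closed_curve:
  assumes "closed_curve X c"
  shows "singular_relcycle 1 X {} (frag_of (curve_simplex c))"
proof -
  have "curve_simplex c (simplical_face k x) = c (if k = 0 then 1 else 0)"
    if "x \<in> standard_simplex 0" and "k \<le> 1" for k x
  proof -
    have "simplical_face k x \<in> standard_simplex 1"
      using simplical_face_in_standard_simplex[of 1 k x] that by simp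
    moreover have "simplical_face k x 1 = (if k = 0 then 1 else 0)"
      using that by (auto simp: simplical_face_def standard_simplex_0)
    ultimately show ?thesis by (simp add: curve_simplex_def)
  qed
  then have "singular_face 1 0 (curve_simplex c) = singular_face 1 1 (curve_simplex c)"
    using assms by (auto simp: fun_eq_iff singular_face_def closed_curve_def)
  then have "chain_boundary 1 (frag_of (curve_simplex c)) = 0"
    by (simp add: chain_boundary_of)
  then show ?thesis
    using singular_simplex_curve[of X c] assms
    by (simp add: singular_cycle singular_chain_of closed_curve_def)
qed

lemma curve_class_in_homology_group:
  assumes "closed_curve X c"
  shows "curve_class X c \<in> carrier (homology_group 1 X)"
proof -
  have "curve_class X c \<in> carrier (relative_homology_group (int 1) X {})"
    unfolding curve_class_def carrier_relative_homology_group
    using singular_relcycle_closed_curve[OF assms] by blast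
  then show ?thesis by simp
qed

section \<open>Intersection number on the standard torus\<close>

definition symplectic_matrix :: "int^2^2" where
  "symplectic_matrix = vector [vector [0, 1], vector [-1, 0]]"

definition symplectic_form :: "int^2 \<Rightarrow> int^2 \<Rightarrow> int" where
  "symplectic_form v w = (\<Sum>i\<in>UNIV. v $ i * (symplectic_matrix *v w) $ i)"

lemma symplectic_form_eq: "symplectic_form v w = v $ 1 * w $ 2 - v $ 2 * w $ 1"
  by (simp add: symplectic_form_def symplectic_matrix_def sum_2 matrix_vector_mult_def)

abbreviation y1_cycle :: "real \<Rightarrow> (real \<times> real) set" where
  "y1_cycle \<equiv> torus_cycle (\<int> \<times> \<int>) (1, 0)"

abbreviation y2_cycle :: "real \<Rightarrow> (real \<times> real) set" where
  "y2_cycle \<equiv> torus_cycle (\<int> \<times> \<int>) (0, 1)"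

definition intersection_form ::
  "(real \<times> real) set chain set \<Rightarrow> (real \<times> real) set chain set \<Rightarrow> int" where
  "intersection_form \<alpha> \<beta> = (THE n. \<exists>v w.
     \<alpha> = int_combination std_torus y1_cycle y2_cycle (v $ 1) (v $ 2) \<and>
     \<beta> = int_combination std_torus y1_cycle y2_cycle (w $ 1) (w $ 2) \<and>
     n = symplectic_form v w)"

definition intersection_number ::
  "(real \<Rightarrow> (real \<times> real) set) \<Rightarrow> (real \<Rightarrow> (real \<times> real) set) \<Rightarrow> int" where
  "intersection_number c c' =
     intersection_form (curve_class std_torus c) (curve_class std_torus c')"

end

theory Submission
  imports Defs "HOL-Analysis.Analysis"
begin

text \<open>For lattice vectors \<open>u\<close> and \<open>v\<close> the straight cycle along \<open>u + v\<close> is homologous to the sum of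
  those along \<open>u\<close> and \<open>v\<close>, so the class of a straight cycle on \<open>T\<close> is linear in its direction; the
  covering maps the straight cycles along \<open>x\<^sub>1\<close>, \<open>x\<^sub>2\<close> to straight cycles, which yields \<open>(e, m)\<close>.
  The intersection form is well defined because \<open>y\<^sub>1\<close>, \<open>y\<^sub>2\<close> are independent in \<open>H\<^sub>1(T)\<close>: for a
  nowhere vanishing \<open>f\<close>, the variation of \<open>log f\<close> along singular 1-simplices is a cocycle, since
  \<open>log f\<close> exists on a whole 2-simplex, and for \<open>f = exp (2 \<pi> \<i> x\<^sub>j)\<close> it reads off the \<open>j\<close>-th
  coordinate of the class.\<close>

section \<open>Logarithmic variation of paths and 1-chains\<close>

text \<open>The increment over the unit interval of a continuous logarithm of the path: for a closed
  path, 2 pi i times its winding number about 0. The value is arbitrary if no such logarithm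
  exists.\<close>

definition log_variation :: "(real \<Rightarrow> complex) \<Rightarrow> complex" where
  "log_variation \<gamma> =
     (SOME d. \<exists>g. continuous_on {0..1} g \<and> (\<forall>t\<in>{0..1}. \<gamma> t = exp (g t)) \<and> d = g 1 - g 0)"

text \<open>Two continuous logarithms of one path differ by a constant, by uniqueness of lifts
  through the covering exp of the punctured plane; hence the choice in \<open>log_variation\<close>
  is immaterial.\<close>

lemma log_variation_eq:
  assumes g: "continuous_on {0..1} g" and eq: "\<And>t. t \<in> {0..1} \<Longrightarrow> \<gamma> t = exp (g t)"
  shows "log_variation \<gamma> = g 1 - g 0"
proof -
  have "h 1 - h 0 = g 1 - g 0"
    if h: "continuous_on {0..1} h" and h_eq: "\<forall>t\<in>{0..1}. \<gamma> t = exp (h t)" for h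
  proof -
    have "exp (h 0) = exp (g 0)"
      using h_eq eq[of 0] by simp
    \<comment> \<open>Uniqueness of lifts needs agreement at one point: the shifted \<open>h\<close>
      takes the value \<open>g 0\<close> at 0 and still lifts the path, since exp (g 0 - h 0) =
      1.\<close>
    then have "\<gamma> t = exp (h t + (g 0 - h 0))" if "t \<in> {0..1}" for t
      using h_eq that by (simp add: exp_add exp_diff)
    moreover have "continuous_on {0..1} \<gamma>"
      using continuous_on_exp[OF g] by (rule continuous_on_eq) (simp add: eq)
    moreover have "continuous_on {0..1} (\<lambda>t. h t + (g 0 - h 0))"
      using h by (intro continuous_intros)
    moreover have "\<gamma> \<in> {0..1} \<rightarrow> - {0}"
      using eq by auto
    ultimately have "h 1 + (g 0 - h 0) = g 1"
      using covering_space_lift_unique[OF covering_space_exp_punctured_plane,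
          of "\<lambda>t. h t + (g 0 - h 0)" 0 g "{0..1}" \<gamma> 1] g eq
      by simp
    then show ?thesis by (simp add: algebra_simps)
  qed
  then show ?thesis
    unfolding log_variation_def using g eq by (intro some_equality) blast+
qed

section \<open>Parametrised edges of the 2-simplex and the cocycle identity\<close>

definition edge_point :: "real \<Rightarrow> nat \<Rightarrow> real" where
  "edge_point t = (\<lambda>i. if i = 0 then 1 - t else if i = 1 then t else 0)"

text \<open>An affine chart that takes (0, 0), (1, 0), (0, 1) to the vertices 0, 1, 2. Its plane
  domain makes the theorem on continuous logarithms applicable.\<close>

definition triangle_point :: "real \<times> real \<Rightarrow> nat \<Rightarrow> real" where
  "triangle_point = (\<lambda>(s, t) i.
     if i = 0 then 1 - s - t else if i = 1 then s else if i = 2 then t else 0)"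

lemma edge_point_in_standard_simplex: "t \<in> {0..1} \<Longrightarrow> edge_point t \<in> standard_simplex 1"
  by (simp add: edge_point_def standard_simplex_def)

lemma triangle_point_in_standard_simplex:
  "0 \<le> s \<Longrightarrow> 0 \<le> t \<Longrightarrow> s + t \<le> 1 \<Longrightarrow> triangle_point (s, t) \<in> standard_simplex 2"
  by (simp add: triangle_point_def standard_simplex_def numeral_2_eq_2)

lemma continuous_map_triangle_point:
  "continuous_map euclidean (powertop_real UNIV) triangle_point"
proof -
  have "continuous_on UNIV (\<lambda>x. triangle_point x i)" for i
    by (cases "i = 0"; cases "i = 1"; cases "i = 2")
       (auto simp: triangle_point_def case_prod_unfold intro!: continuous_intros)
  then show ?thesis by (simp add: continuous_map_componentwise_UNIV)
qed

text \<open>Face \<open>j\<close> omits vertex \<open>j\<close> and keeps the order of the others,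
  so the edges run from 1 to 2, from 0 to 2 and from 0 to 1.\<close>

lemma singular_face_2_edge_point:
  assumes "t \<in> {0..1}"
  shows "singular_face 2 0 \<sigma> (edge_point t) = \<sigma> (triangle_point (1 - t, t))"
    and "singular_face 2 1 \<sigma> (edge_point t) = \<sigma> (triangle_point (0, t))"
    and "singular_face 2 2 \<sigma> (edge_point t) = \<sigma> (triangle_point (t, 0))"
proof -
  have "simplical_face 0 (edge_point t) = triangle_point (1 - t, t)"
    and "simplical_face 1 (edge_point t) = triangle_point (0, t)"
    and "simplical_face 2 (edge_point t) = triangle_point (t, 0)"
    by (auto simp: fun_eq_iff simplical_face_def edge_point_def triangle_point_def)
  then show "singular_face 2 0 \<sigma> (edge_point t) = \<sigma> (triangle_point (1 - t, t))"
    and "singular_face 2 1 \<sigma> (edge_point t) = \<sigma> (triangle_point (0, t))"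
    and "singular_face 2 2 \<sigma> (edge_point t) = \<sigma> (triangle_point (t, 0))"
    using edge_point_in_standard_simplex[OF assms] by (simp_all add: singular_face_def)
qed

definition simplex_log :: "('a \<Rightarrow> complex) \<Rightarrow> ((nat \<Rightarrow> real) \<Rightarrow> 'a) \<Rightarrow> complex" where
  "simplex_log f \<sigma> = log_variation (\<lambda>t. f (\<sigma> (edge_point t)))"

text \<open>The triangle is convex, hence contractible, so a single logarithm \<open>G\<close>
  serves all three edges; the differences of its values at the vertices cancel in the alternating
  sum.\<close>

lemma simplex_log_face_sum:
  assumes \<sigma>: "singular_simplex 2 X \<sigma>" and f: "continuous_map X euclidean f"
    and nz: "\<And>x. x \<in> topspace X \<Longrightarrow> f x \<noteq> 0"
  shows "simplex_log f (singular_face 2 0 \<sigma>) - simplex_log f (singular_face 2 1 \<sigma>)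
    + simplex_log f (singular_face 2 2 \<sigma>) = 0"
proof -
  define D where "D = {x :: real \<times> real. 0 \<le> fst x \<and> 0 \<le> snd x \<and> fst x + snd x \<le> 1}"
  have "D = {x. (1, 0) \<bullet> x \<ge> 0} \<inter> {x. (0, 1) \<bullet> x \<ge> 0} \<inter> {x. (1, 1) \<bullet> x \<le> 1}"
    by (auto simp: D_def inner_prod_def)
  then have "convex D"
    by (simp only: convex_Int convex_halfspace_ge convex_halfspace_le)
  have cont_D: "continuous_map (top_of_set D)
      (subtopology (powertop_real UNIV) (standard_simplex 2)) triangle_point"
    using continuous_map_triangle_point triangle_point_in_standard_simplex
    by (auto simp: continuous_map_in_subtopology continuous_map_from_subtopology D_def)
  have \<sigma>_cont: "continuous_map (subtopology (powertop_real UNIV) (standard_simplex 2)) X \<sigma>"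
    using \<sigma> by (simp add: singular_simplex_def)
  have "continuous_map (top_of_set D) X (\<sigma> \<circ> triangle_point)"
    using continuous_map_compose[OF cont_D \<sigma>_cont] .
  then have "continuous_map (top_of_set D) euclidean (f \<circ> (\<sigma> \<circ> triangle_point))"
    and in_X: "\<And>x. x \<in> D \<Longrightarrow> \<sigma> (triangle_point x) \<in> topspace X"
    using f continuous_map_compose by (blast, auto simp: continuous_map_def)
  then have "continuous_on D (\<lambda>x. f (\<sigma> (triangle_point x)))"
    by (simp add: o_def)
  then obtain G where G: "continuous_on D G"
    and G_eq: "\<And>x. x \<in> D \<Longrightarrow> f (\<sigma> (triangle_point x)) = exp (G x)"
    using continuous_logarithm_on_contractible[OF _ convex_imp_contractible[OF \<open>convex D\<close>]]
      nz in_X by metis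
  have face: "simplex_log f (singular_face 2 j \<sigma>) = G (r 1) - G (r 0)"
    if "\<And>t. t \<in> {0..1} \<Longrightarrow> r t \<in> D" "continuous_on {0..1} r"
      "\<And>t. t \<in> {0..1} \<Longrightarrow> singular_face 2 j \<sigma> (edge_point t) = \<sigma> (triangle_point (r t))"
    for j r
  proof -
    have "continuous_on {0..1} (\<lambda>t. G (r t))"
      using continuous_on_compose2[OF G that(2)] that(1) by blast
    then show ?thesis
      unfolding simplex_log_def by (rule log_variation_eq) (simp add: that G_eq)
  qed
  have "simplex_log f (singular_face 2 0 \<sigma>) = G (0, 1) - G (1, 0)"
    using face[of "\<lambda>t. (1 - t, t)" 0]
    by (simp add: D_def continuous_intros singular_face_2_edge_point)
  moreover have "simplex_log f (singular_face 2 1 \<sigma>) = G (0, 1) - G (0, 0)"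
    using face[of "\<lambda>t. (0, t)" 1]
    by (simp add: D_def continuous_intros singular_face_2_edge_point del: One_nat_def)
  moreover have "simplex_log f (singular_face 2 2 \<sigma>) = G (1, 0) - G (0, 0)"
    using face[of "\<lambda>t. (t, 0)" 2]
    by (simp add: D_def continuous_intros singular_face_2_edge_point)
  ultimately show ?thesis by simp
qed

section \<open>Linear extension to chains and homology invariance\<close>

definition chain_log :: "('a \<Rightarrow> complex) \<Rightarrow> 'a chain \<Rightarrow> complex" where
  "chain_log f c =
     (\<Sum>\<sigma>\<in>Poly_Mapping.keys c. of_int (Poly_Mapping.lookup c \<sigma>) * simplex_log f \<sigma>)"

text \<open>Lets several chains be summed over a common index set, although supports change under
  the chain operations.\<close>

lemma chain_log_superset:
  assumes "finite S" "Poly_Mapping.keys c \<subseteq> S"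
  shows "chain_log f c = (\<Sum>\<sigma>\<in>S. of_int (Poly_Mapping.lookup c \<sigma>) * simplex_log f \<sigma>)"
  unfolding chain_log_def using assms by (intro sum.mono_neutral_left) (auto simp: in_keys_iff)

lemma chain_log_0: "chain_log f 0 = 0"
  by (simp add: chain_log_def)

lemma chain_log_frag_of: "chain_log f (frag_of \<sigma>) = simplex_log f \<sigma>"
  by (simp add: chain_log_def)

lemma chain_log_cmul: "chain_log f (frag_cmul n c) = of_int n * chain_log f c"
  \<comment> \<open>For \<open>n = 0\<close> the support becomes empty, so the sum is taken over the
    support of \<open>c\<close>.\<close>
  by (subst chain_log_superset[of "Poly_Mapping.keys c"])
     (auto simp: chain_log_def sum_distrib_left mult.assoc)

lemma chain_log_add: "chain_log f (a + b) = chain_log f a + chain_log f b"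
proof -
  let ?S = "Poly_Mapping.keys a \<union> Poly_Mapping.keys b"
  have "chain_log f (a + b)
      = (\<Sum>\<sigma>\<in>?S. of_int (Poly_Mapping.lookup (a + b) \<sigma>) * simplex_log f \<sigma>)"
    by (rule chain_log_superset) (use keys_add[of a b] in auto)
  also have "\<dots> = chain_log f a + chain_log f b"
    by (simp add: chain_log_superset[of ?S a] chain_log_superset[of ?S b] lookup_add
        distrib_right sum.distrib)
  finally show ?thesis .
qed

lemma chain_log_diff: "chain_log f (a - b) = chain_log f a - chain_log f b"
  using chain_log_add[of f "a - b" b] by simp

text \<open>By linearity it suffices to treat a single simplex, where this is
  \<open>simplex_log_face_sum\<close>.\<close>

lemma chain_log_boundary:
  assumes c: "singular_chain 2 X c" and f: "continuous_map X euclidean f"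
    and nz: "\<And>x. x \<in> topspace X \<Longrightarrow> f x \<noteq> 0"
  shows "chain_log f (chain_boundary 2 c) = 0"
  using c unfolding singular_chain_def
proof (induction c rule: frag_induction)
  case zero
  then show ?case by (simp add: chain_log_0)
next
  case (one \<sigma>)
  have "chain_boundary 2 (frag_of \<sigma>) = frag_of (singular_face 2 0 \<sigma>)
      - frag_of (singular_face 2 1 \<sigma>) + frag_of (singular_face 2 2 \<sigma>)"
    by (simp add: chain_boundary_of numeral_2_eq_2)
  then show ?case
    using simplex_log_face_sum[OF _ f nz, of \<sigma>] one
    by (simp add: chain_log_add chain_log_diff chain_log_frag_of)
next
  case (diff a b)
  then show ?case by (simp add: chain_boundary_diff chain_log_diff)
qed

text \<open>The difference is the boundary of a 2-chain, which \<open>chain_log\<close> kills; thus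
  \<open>chain_log\<close> descends to homology classes.\<close>

lemma chain_log_homologous:
  assumes "homologous_rel 1 X {} a b" and f: "continuous_map X euclidean f"
    and nz: "\<And>x. x \<in> topspace X \<Longrightarrow> f x \<noteq> 0"
  shows "chain_log f a = chain_log f b"
proof -
  obtain d where "singular_chain 2 X d" "chain_boundary 2 d = a - b"
    using assms(1) by (auto simp: homologous_rel_def singular_boundary numeral_2_eq_2)
  then show ?thesis
    using chain_log_boundary[OF _ f nz] by (metis chain_log_diff eq_iff_diff_eq_0)
qed

lemma chain_log_curve:
  assumes "continuous_on {0..1} g" and "\<And>t. t \<in> {0..1} \<Longrightarrow> f (c t) = exp (g t)"
  shows "chain_log f (frag_of (curve_simplex c)) = g 1 - g 0"
  unfolding chain_log_frag_of simplex_log_def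
proof (rule log_variation_eq[OF assms(1)])
  fix t :: real assume "t \<in> {0..1}"
  then show "f (curve_simplex c (edge_point t)) = exp (g t)"
    using edge_point_in_standard_simplex[of t] assms(2)
    \<comment> \<open>The restriction in \<open>curve_simplex\<close> is discharged while
      \<open>edge_point t\<close> is still folded, as in the membership fact; only then is its
      coordinate 1 computed.\<close>
    by (simp add: curve_simplex_def) (simp add: edge_point_def)
qed

section \<open>Homology classes of curves\<close>

text \<open>Turns additivity into integer powers, both for multiples of a cycle and for multiples of
  the direction of a straight cycle.\<close>

lemma (in group) additive_int_eq_int_pow:
  fixes h :: "int \<Rightarrow> 'a"
  assumes "\<And>n. h n \<in> carrier G" and "\<And>m n. h (m + n) = h m \<otimes> h n"
  shows "h n = h 1 [^] n"
proof (induction n rule: int_induct[where k = 0])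
  case base
  have "h 0 \<otimes> h 0 = h 0" using assms(2)[of 0 0] by simp
  then show ?case using assms(1)[of 0] by (simp add: r_cancel_one')
next
  case (step1 n)
  then show ?case by (simp add: assms int_pow_mult)
next
  case (step2 n)
  \<comment> \<open>Downward step: both sides equal \<open>h n\<close>, and \<open>h 1\<close> is
    cancelled on the right.\<close>
  have "h (n - 1) \<otimes> h 1 = h 1 [^] (n - 1) \<otimes> h 1"
    using step2 assms int_pow_mult[OF assms(1)[of 1], of "n - 1" 1]
    by (metis diff_add_cancel int_pow_1)
  then show ?case using assms by simp
qed

lemma homologous_rel_set_mult:
  assumes "singular_relcycle 1 X {} a" "singular_relcycle 1 X {} b"
  shows "homologous_rel_set 1 X {} a \<otimes>\<^bsub>homology_group 1 X\<^esub> homologous_rel_set 1 X {} b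
    = homologous_rel_set 1 X {} (a + b)"
proof -
  have "homologous_rel_set 1 X {} a \<otimes>\<^bsub>relative_homology_group (int 1) X {}\<^esub>
      homologous_rel_set 1 X {} b = homologous_rel_set 1 X {} (a + b)"
  proof (intro equalityI subsetI)
    fix c assume "c \<in> homologous_rel_set 1 X {} (a + b)"
    \<comment> \<open>The product in the library is the set of all sums of representatives;
      \<open>c\<close> is the sum of \<open>a\<close> and the representative \<open>c - a\<close> of
      the class of \<open>b\<close>.\<close>
    then have "homologous_rel 1 X {} b (c - a)"
      using homologous_rel_diff[OF _ homologous_rel_refl, of 1 X "{}" "a + b" c a] by simp
    then show "c \<in> homologous_rel_set 1 X {} a \<otimes>\<^bsub>relative_homology_group (int 1) X {}\<^esub>
        homologous_rel_set 1 X {} b"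
      unfolding mult_relative_homology_group
      by (intro UN_I[of a] UN_I[of "c - a"]) auto
  qed (auto simp only: mult_relative_homology_group UN_iff mem_Collect_eq singleton_iff
      intro: homologous_rel_add)
  then show ?thesis by simp
qed

lemma homologous_rel_set_in_homology_group:
  assumes "singular_relcycle 1 X {} a"
  shows "homologous_rel_set 1 X {} a \<in> carrier (homology_group 1 X)"
  using carrier_relative_homology_group[of 1 X "{}"] assms by auto

lemma homologous_rel_set_int_pow:
  assumes "singular_relcycle 1 X {} a"
  shows "homologous_rel_set 1 X {} a [^]\<^bsub>homology_group 1 X\<^esub> (n::int)
    = homologous_rel_set 1 X {} (frag_cmul n a)"
proof -
  have "singular_relcycle 1 X {} (frag_cmul m a)" for m
    using assms by (simp add: singular_cycle singular_chain_cmul chain_boundary_cmul)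
  then show ?thesis
    using group.additive_int_eq_int_pow[OF group_relative_homology_group,
        of "\<lambda>m. homologous_rel_set 1 X {} (frag_cmul m a)" 1 X "{}" n]
    by (simp add: frag_cmul_distrib homologous_rel_set_mult homologous_rel_set_in_homology_group
        del: One_nat_def)
qed

text \<open>Provides an explicit cycle on which \<open>chain_log\<close> can be evaluated.\<close>

lemma int_combination_eq_homologous_rel_set:
  assumes "closed_curve X a" "closed_curve X b"
  shows "int_combination X a b p q = homologous_rel_set 1 X {}
    (frag_cmul p (frag_of (curve_simplex a)) + frag_cmul q (frag_of (curve_simplex b)))"
  using assms[THEN singular_relcycle_closed_curve]
  by (simp add: int_combination_def curve_class_def homologous_rel_set_int_pow
      homologous_rel_set_mult singular_cycle singular_chain_cmul chain_boundary_cmul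
      del: One_nat_def)

lemma hom_induced_curve_class:
  assumes "continuous_map X Y f" and "closed_curve X c"
  shows "hom_induced 1 X {} Y {} f (curve_class X c) = curve_class Y (f \<circ> c)"
proof -
  have "simplex_map 1 f (curve_simplex c) = curve_simplex (f \<circ> c)"
    by (auto simp: simplex_map_def curve_simplex_def fun_eq_iff)
  then show ?thesis
    using hom_induced_chain_map[OF assms(1) _ singular_relcycle_closed_curve[OF assms(2)], of "{}"]
    by (simp add: curve_class_def)
qed

text \<open>The induced map is a group homomorphism and sends the class of a curve to that of its
  image, so the coefficients survive.\<close>

lemma has_homology_class_image:
  assumes f: "continuous_map X Y f"
    and closed: "closed_curve X a" "closed_curve X b" "closed_curve X c"
    and c: "has_homology_class X a b c p q"
  shows "has_homology_class Y (f \<circ> a) (f \<circ> b) (f \<circ> c) p q"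
proof -
  interpret h: group_hom "homology_group 1 X" "homology_group 1 Y" "hom_induced 1 X {} Y {} f"
    by (simp add: group_hom_def group_hom_axioms_def hom_induced_hom)
  show ?thesis
    using c closed[THEN curve_class_in_homology_group]
    unfolding has_homology_class_def int_combination_def
    by (simp add: h.hom_int_pow closed flip: hom_induced_curve_class[OF f])
qed

section \<open>Straight cycles on plane tori\<close>

text \<open>The segment from 0 to \<open>v\<close> closes up because \<open>v\<close> is a period.
  Periodicity of cosets, rather than a form of the lattice, is assumed so that both tori are
  served.\<close>

lemma closed_curve_torus_cycle:
  assumes "\<And>x. plane_coset \<Gamma> (x + v) = plane_coset \<Gamma> x"
  shows "closed_curve (torus \<Gamma>) (torus_cycle \<Gamma> v)"
proof -
  have "continuous_map (top_of_set {0..1}) euclidean (\<lambda>t::real. t *\<^sub>R v)"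
    by (simp add: continuous_intros)
  then have "pathin (torus \<Gamma>) (plane_coset \<Gamma> \<circ> (\<lambda>t. t *\<^sub>R v))"
    unfolding pathin_def
    using quotient_map_plane_coset continuous_map_compose quotient_imp_continuous_map by blast
  then show ?thesis
    using assms[of 0] by (simp add: closed_curve_def torus_cycle_def o_def)
qed

text \<open>The affine triangle with vertices \<open>0\<close>, \<open>u\<close>, \<open>u + v\<close> descends to a singular 2-simplex whose
  edges are the three straight cycles.\<close>

lemma curve_class_torus_cycle_add:
  assumes u: "\<And>x. plane_coset \<Gamma> (x + u) = plane_coset \<Gamma> x"
    and v: "\<And>x. plane_coset \<Gamma> (x + v) = plane_coset \<Gamma> x"
  shows "curve_class (torus \<Gamma>) (torus_cycle \<Gamma> (u + v)) =
    curve_class (torus \<Gamma>) (torus_cycle \<Gamma> u) \<otimes>\<^bsub>homology_group 1 (torus \<Gamma>)\<^esub>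
    curve_class (torus \<Gamma>) (torus_cycle \<Gamma> v)"
proof -
  let ?s = "\<lambda>w. curve_simplex (torus_cycle \<Gamma> w)"
  define \<tau> where "\<tau> = (\<lambda>x::nat \<Rightarrow> real. x 1 *\<^sub>R u + x 2 *\<^sub>R (u + v))"
  define \<sigma> where "\<sigma> = restrict (plane_coset \<Gamma> \<circ> \<tau>) (standard_simplex 2)"
  have "continuous_map (powertop_real UNIV) euclidean \<tau>"
    unfolding \<tau>_def
    by (simp add: euclidean_product_topology)
       (intro continuous_intros continuous_on_product_coordinates)
  then have "continuous_map (powertop_real UNIV) (torus \<Gamma>) (plane_coset \<Gamma> \<circ> \<tau>)"
    using quotient_map_plane_coset continuous_map_compose quotient_imp_continuous_map by blast
  then have "continuous_map (subtopology (powertop_real UNIV) (standard_simplex 2)) (torus \<Gamma>)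
      (plane_coset \<Gamma> \<circ> \<tau>)"
    by (rule continuous_map_from_subtopology)
  then have \<sigma>: "singular_simplex 2 (torus \<Gamma>) \<sigma>"
    unfolding singular_simplex_def \<sigma>_def by (auto elim: continuous_map_eq)
  have face: "singular_face 2 j \<sigma> = ?s w"
    if "j \<le> 2" "\<And>x. x \<in> standard_simplex 1 \<Longrightarrow>
      plane_coset \<Gamma> (\<tau> (simplical_face j x)) = plane_coset \<Gamma> (x 1 *\<^sub>R w)" for j w
    using that simplical_face_in_standard_simplex[of 2 j]
    by (auto simp: fun_eq_iff singular_face_def \<sigma>_def curve_simplex_def torus_cycle_def)
  have sum1: "x 0 = 1 - x 1" if "x \<in> standard_simplex 1" for x
    using that by (simp add: standard_simplex_def)
  have "singular_face 2 0 \<sigma> = ?s v"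
  proof (rule face)
    fix x :: "nat \<Rightarrow> real" assume "x \<in> standard_simplex 1"
    \<comment> \<open>The edge opposite vertex 0 starts at \<open>u\<close>; the period
      \<open>u\<close> moves it onto the straight cycle along \<open>v\<close>.\<close>
    then have "\<tau> (simplical_face 0 x) = x 1 *\<^sub>R v + u"
      by (simp add: \<tau>_def simplical_face_def sum1 algebra_simps)
    then show "plane_coset \<Gamma> (\<tau> (simplical_face 0 x)) = plane_coset \<Gamma> (x 1 *\<^sub>R v)"
      using u by simp
  qed simp
  moreover have "singular_face 2 1 \<sigma> = ?s (u + v)" "singular_face 2 2 \<sigma> = ?s u"
    by (rule face; simp add: \<tau>_def simplical_face_def)+
  ultimately have "chain_boundary 2 (frag_of \<sigma>)
      = (frag_of (?s u) + frag_of (?s v)) - frag_of (?s (u + v))"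
    by (simp add: chain_boundary_of numeral_2_eq_2)
  then have "homologous_rel 1 (torus \<Gamma>) {} (frag_of (?s u) + frag_of (?s v)) (frag_of (?s (u + v)))"
    using \<sigma> by (auto simp: homologous_rel_def singular_boundary numeral_2_eq_2
        singular_chain_of intro!: exI[of _ "frag_of \<sigma>"])
  then show ?thesis
    using closed_curve_torus_cycle[OF u, THEN singular_relcycle_closed_curve]
      closed_curve_torus_cycle[OF v, THEN singular_relcycle_closed_curve]
    by (simp add: curve_class_def homologous_rel_set_mult homologous_rel_set_eq homologous_rel_sym
        del: One_nat_def)
qed

lemma plane_coset_add_int_scaleR:
  assumes v: "\<And>x. plane_coset \<Gamma> (x + v) = plane_coset \<Gamma> x"
  shows "plane_coset \<Gamma> (x + of_int n *\<^sub>R v) = plane_coset \<Gamma> x"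
proof (induction n rule: int_induct[where k = 0])
  case base
  then show ?case by simp
next
  case (step1 n)
  then show ?case using v[of "x + of_int n *\<^sub>R v"] by (simp add: algebra_simps)
next
  case (step2 n)
  then show ?case using v[of "x + of_int (n - 1) *\<^sub>R v"] by (simp add: algebra_simps)
qed

text \<open>Additivity in the direction gives powers for multiples of one period; one more addition
  combines the two periods.\<close>

lemma curve_class_torus_cycle_int_combination:
  assumes u: "\<And>x. plane_coset \<Gamma> (x + u) = plane_coset \<Gamma> x"
    and v: "\<And>x. plane_coset \<Gamma> (x + v) = plane_coset \<Gamma> x"
  shows "curve_class (torus \<Gamma>) (torus_cycle \<Gamma> (of_int p *\<^sub>R u + of_int q *\<^sub>R v)) =
    int_combination (torus \<Gamma>) (torus_cycle \<Gamma> u) (torus_cycle \<Gamma> v) p q"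
proof -
  have multiple: "curve_class (torus \<Gamma>) (torus_cycle \<Gamma> (of_int n *\<^sub>R w)) =
      curve_class (torus \<Gamma>) (torus_cycle \<Gamma> w) [^]\<^bsub>homology_group 1 (torus \<Gamma>)\<^esub> n"
    if w: "\<And>x. plane_coset \<Gamma> (x + w) = plane_coset \<Gamma> x" for w and n :: int
    using group.additive_int_eq_int_pow[OF group_relative_homology_group,
        of "\<lambda>n. curve_class (torus \<Gamma>) (torus_cycle \<Gamma> (of_int n *\<^sub>R w))" 1 "torus \<Gamma>" "{}" n]
      plane_coset_add_int_scaleR[OF w]
    by (simp add: scaleR_add_left curve_class_torus_cycle_add curve_class_in_homology_group
        closed_curve_torus_cycle)
  show ?thesis
    using curve_class_torus_cycle_add[OF plane_coset_add_int_scaleR[OF u]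
        plane_coset_add_int_scaleR[OF v]]
    by (simp add: multiple[OF u] multiple[OF v] int_combination_def)
qed

lemma plane_coset_lattice_periods:
  shows "plane_coset (plane_lattice u v) (x + u) = plane_coset (plane_lattice u v) x"
    and "plane_coset (plane_lattice u v) (x + v) = plane_coset (plane_lattice u v) x"
  by (rule plane_coset_lattice_eqI[of _ _ 1 _ 0], simp)
     (rule plane_coset_lattice_eqI[of _ _ 0 _ 1], simp)

section \<open>The standard torus\<close>

lemma Ints_times_Ints_eq_lattice: "\<int> \<times> \<int> = plane_lattice (1, 0) (0, 1)"
  by (auto simp: plane_lattice_def elim!: Ints_cases)

lemma plane_coset_add_Ints:
  "plane_coset (\<int> \<times> \<int>) (x + (of_int a, of_int b)) = plane_coset (\<int> \<times> \<int>) x"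
  unfolding Ints_times_Ints_eq_lattice by (rule plane_coset_lattice_eqI[of _ _ a _ b]) simp

lemma closed_curve_y_cycles:
  "closed_curve std_torus y1_cycle" "closed_curve std_torus y2_cycle"
  unfolding std_torus_def
  using plane_coset_add_Ints[of _ 1 0] plane_coset_add_Ints[of _ 0 1]
  by (auto intro: closed_curve_torus_cycle)

text \<open>The character exp (2 pi i l) of the torus, evaluated at a chosen representative of the
  coset.\<close>

definition torus_char :: "(real \<times> real \<Rightarrow> real) \<Rightarrow> (real \<times> real) set \<Rightarrow> complex" where
  "torus_char l c = exp (2 * pi * l (SOME x. x \<in> c) * \<i>)"

text \<open>Representatives differ by an integer vector, on which \<open>l\<close> is an integer, so
  the exponents differ by a multiple of 2 pi i.\<close>

lemma torus_char_plane_coset: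
  assumes "linear l" "l ` (\<int> \<times> \<int>) \<subseteq> \<int>"
  shows "torus_char l (plane_coset (\<int> \<times> \<int>) x) = exp (2 * pi * l x * \<i>)"
proof -
  define y where "y = (SOME y. y \<in> plane_coset (\<int> \<times> \<int>) x)"
  have "x + (0, 0) \<in> plane_coset (\<int> \<times> \<int>) x"
    unfolding plane_coset_def by (intro imageI) simp
  then have "y \<in> plane_coset (\<int> \<times> \<int>) x"
    unfolding y_def by (rule someI)
  then obtain z where "z \<in> \<int> \<times> \<int>" and y: "y = x + z"
    by (auto simp: plane_coset_def)
  then obtain n where "l z = of_int n"
    using assms(2) by (blast elim: Ints_cases)
  then have "complex_of_real (2 * pi * l y) * \<i>
      = complex_of_real (2 * pi * l x) * \<i> + \<i> * (of_int n * (of_real pi * 2))"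
    by (simp add: y linear_add[OF assms(1)] algebra_simps)
  then show ?thesis
    by (simp only: torus_char_def exp_plus_2pin flip: y_def)
qed

text \<open>Applying \<open>chain_log\<close> with a character to the two homologous cycles yields
  equal values of 2 pi i (p l(1, 0) + q l(0, 1)); the coordinate functions as \<open>l\<close> then
  isolate the coefficients.\<close>

lemma y_cycles_independent:
  assumes "int_combination std_torus y1_cycle y2_cycle p q
    = int_combination std_torus y1_cycle y2_cycle p' q'"
  shows "p = p' \<and> q = q'"
proof -
  have rel: "homologous_rel 1 std_torus {}
     (frag_cmul p (frag_of (curve_simplex y1_cycle)) + frag_cmul q (frag_of (curve_simplex y2_cycle)))
     (frag_cmul p' (frag_of (curve_simplex y1_cycle)) + frag_cmul q' (frag_of (curve_simplex y2_cycle)))"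
    using assms
    by (simp add: int_combination_eq_homologous_rel_set closed_curve_y_cycles homologous_rel_set_eq)
  have "of_int p * l (1, 0) + of_int q * l (0, 1) = of_int p' * l (1, 0) + of_int q' * l (0, 1)"
    if l: "linear l" "l ` (\<int> \<times> \<int>) \<subseteq> \<int>" for l :: "real \<times> real \<Rightarrow> real"
  proof -
    note char = torus_char_plane_coset[OF l]
    have "continuous_on UNIV l"
      using l(1) linear_continuous_on linear_conv_bounded_linear by blast
    then have "continuous_map euclidean euclidean (torus_char l \<circ> plane_coset (\<int> \<times> \<int>))"
      by (simp add: o_def char) (intro continuous_intros)
    then have cont: "continuous_map std_torus euclidean (torus_char l)"
      unfolding std_torus_def by (rule continuous_compose_quotient_map[OF quotient_map_plane_coset])
    \<comment> \<open>By linearity of \<open>l\<close>, the function 2 pi i t l(v) is an explicit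
      logarithm of the character along the straight cycle.\<close>
    have cycle: "chain_log (torus_char l) (frag_of (curve_simplex (torus_cycle (\<int> \<times> \<int>) v)))
        = 2 * pi * l v * \<i>" for v
      using chain_log_curve[of "\<lambda>t. 2 * pi * (t * l v) * \<i>" "torus_char l" "torus_cycle (\<int> \<times> \<int>) v"]
      by (simp add: torus_cycle_def char linear_scale[OF l(1)] continuous_intros)
    have "of_int p * (2 * pi * l (1, 0) * \<i>) + of_int q * (2 * pi * l (0, 1) * \<i>)
        = of_int p' * (2 * pi * l (1, 0) * \<i>) + of_int q' * (2 * pi * l (0, 1) * \<i>)"
      using chain_log_homologous[OF rel cont]
      \<comment> \<open>The second call supplies the non-vanishing of the character, which is an
        exponential.\<close>
      by (simp add: chain_log_add chain_log_cmul cycle) (simp add: torus_char_def)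
    then have "2 * pi * \<i> * of_real (of_int p * l (1, 0) + of_int q * l (0, 1))
        = 2 * pi * \<i> * of_real (of_int p' * l (1, 0) + of_int q' * l (0, 1))"
      by (simp add: algebra_simps)
    then show ?thesis
      by (simp only: mult_cancel_left of_real_eq_iff) simp
  qed
  from this[of fst] this[of snd] show ?thesis
    by (auto simp: linear_fst linear_snd)
qed

text \<open>Independence of the two cycles makes the coordinate vectors unique, so the definite
  description denotes.\<close>

lemma intersection_form_int_combination:
  "intersection_form (int_combination std_torus y1_cycle y2_cycle a b)
     (int_combination std_torus y1_cycle y2_cycle c d) = a * d - b * c"
  unfolding intersection_form_def
proof (rule the_equality)
  show "\<exists>v w. int_combination std_torus y1_cycle y2_cycle a b
        = int_combination std_torus y1_cycle y2_cycle (v $ 1) (v $ 2) \<and>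
      int_combination std_torus y1_cycle y2_cycle c d
        = int_combination std_torus y1_cycle y2_cycle (w $ 1) (w $ 2) \<and>
      a * d - b * c = symplectic_form v w"
    by (rule exI[of _ "vector [a, b]"], rule exI[of _ "vector [c, d]"])
       (simp add: symplectic_form_eq)
qed (auto simp: symplectic_form_eq dest!: y_cycles_independent)

text \<open>The covering carries the straight cycles along \<open>x\<^sub>1\<close> and
  \<open>x\<^sub>2\<close> to those along the same vectors in the standard torus, where these have
  integer coordinates.\<close>

lemma has_homology_class_covering_proj:
  fixes k k' i p q :: int
  defines "x\<^sub>1 \<equiv> (of_int k, 0)" and "x\<^sub>2 \<equiv> (of_int i, of_int k')"
  defines "\<Gamma> \<equiv> plane_lattice x\<^sub>1 x\<^sub>2"
  assumes "closed_curve (torus \<Gamma>) C"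
    and "has_homology_class (torus \<Gamma>) (torus_cycle \<Gamma> x\<^sub>1) (torus_cycle \<Gamma> x\<^sub>2) C p q"
  shows "has_homology_class std_torus y1_cycle y2_cycle (covering_proj \<circ> C)
    (p * k + q * i) (q * k')"
proof -
  let ?Z = "\<int> \<times> \<int> :: (real \<times> real) set"
  have proj: "covering_proj (plane_coset \<Gamma> x) = plane_coset ?Z x" for x
    unfolding \<Gamma>_def x\<^sub>1_def x\<^sub>2_def
    by (intro covering_proj_plane_coset lattice_subset_Ints zero_in_lattice)
  \<comment> \<open>A map out of a quotient is continuous once its composite with the projection is;
    here the composite is the projection onto the standard torus.\<close>
  then have "covering_proj \<circ> plane_coset \<Gamma> = plane_coset ?Z"
    by auto
  then have "continuous_map (torus \<Gamma>) std_torus covering_proj"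
    unfolding std_torus_def
    using continuous_compose_quotient_map[OF quotient_map_plane_coset]
      quotient_imp_continuous_map[OF quotient_map_plane_coset] by metis
  moreover have "closed_curve (torus \<Gamma>) (torus_cycle \<Gamma> x\<^sub>1)" "closed_curve (torus \<Gamma>) (torus_cycle \<Gamma> x\<^sub>2)"
    unfolding \<Gamma>_def by (intro closed_curve_torus_cycle plane_coset_lattice_periods)+
  moreover have "covering_proj \<circ> torus_cycle \<Gamma> v = torus_cycle ?Z v" for v
    by (simp add: torus_cycle_def proj o_def)
  ultimately have "has_homology_class std_torus (torus_cycle ?Z x\<^sub>1) (torus_cycle ?Z x\<^sub>2)
      (covering_proj \<circ> C) p q"
    using has_homology_class_image assms(4,5) by metis
  then have "curve_class std_torus (covering_proj \<circ> C)
      = curve_class std_torus (torus_cycle ?Z (of_int p *\<^sub>R x\<^sub>1 + of_int q *\<^sub>R x\<^sub>2))"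
    using curve_class_torus_cycle_int_combination[of ?Z x\<^sub>1 x\<^sub>2 p q]
      plane_coset_add_Ints[of _ k 0] plane_coset_add_Ints[of _ i k']
    by (simp add: has_homology_class_def std_torus_def x\<^sub>1_def x\<^sub>2_def)
  \<comment> \<open>The image class is that of one straight cycle, whose direction is now expanded
    in the standard basis.\<close>
  also have "of_int p *\<^sub>R x\<^sub>1 + of_int q *\<^sub>R x\<^sub>2
      = of_int (p * k + q * i) *\<^sub>R (1, 0) + of_int (q * k') *\<^sub>R (0, 1)"
    by (simp add: x\<^sub>1_def x\<^sub>2_def)
  also have "curve_class std_torus (torus_cycle ?Z \<dots>)
      = int_combination std_torus y1_cycle y2_cycle (p * k + q * i) (q * k')"
    unfolding std_torus_def
    using plane_coset_add_Ints[of _ 1 0] plane_coset_add_Ints[of _ 0 1]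
    by (intro curve_class_torus_cycle_int_combination) auto
  finally show ?thesis by (simp add: has_homology_class_def o_def)
qed

theorem mainTheorem2:
  fixes N k k' i p q p' q' :: int
    and x\<^sub>1 x\<^sub>2 :: "real \<times> real"
    and \<Gamma> :: "(real \<times> real) set"
    and C C' :: "real \<Rightarrow> (real \<times> real) set"
  assumes "N > 0" and "k > 0" and "k' > 0" and "k * k' = N"
    and "0 \<le> i" and "i < k"
    and "x\<^sub>1 = (of_int k, 0)" and "x\<^sub>2 = (of_int i, of_int k')"
    and "\<Gamma> = plane_lattice x\<^sub>1 x\<^sub>2"
    and "closed_curve (torus \<Gamma>) C" and "closed_curve (torus \<Gamma>) C'"
    and "has_homology_class (torus \<Gamma>) (torus_cycle \<Gamma> x\<^sub>1) (torus_cycle \<Gamma> x\<^sub>2) C p q"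
    and "has_homology_class (torus \<Gamma>) (torus_cycle \<Gamma> x\<^sub>1) (torus_cycle \<Gamma> x\<^sub>2) C' p' q'"
  shows "let e = p * k + q * i; m = q * k'; e' = p' * k + q' * i; m' = q' * k' in
      has_homology_class std_torus y1_cycle y2_cycle (covering_proj \<circ> C) e m \<and>
      has_homology_class std_torus y1_cycle y2_cycle (covering_proj \<circ> C') e' m' \<and>
      intersection_number (covering_proj \<circ> C) (covering_proj \<circ> C') = e * m' - m * e' \<and>
      e * m' - m * e' = (p * q' - q * p') * N \<and>
      [e * m' - m * e' = 0] (mod N)"
proof -
  have C: "has_homology_class std_torus y1_cycle y2_cycle (covering_proj \<circ> C)
      (p * k + q * i) (q * k')"
    and C': "has_homology_class std_torus y1_cycle y2_cycle (covering_proj \<circ> C')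
      (p' * k + q' * i) (q' * k')"
    using assms has_homology_class_covering_proj by blast+
  have "intersection_number (covering_proj \<circ> C) (covering_proj \<circ> C')
      = (p * k + q * i) * (q' * k') - (q * k') * (p' * k + q' * i)"
    using C C'
    by (simp add: intersection_number_def has_homology_class_def intersection_form_int_combination)
  \<comment> \<open>The terms containing \<open>i\<close> cancel, leaving a multiple of
    \<open>k * k'\<close>.\<close>
  moreover have "(p * k + q * i) * (q' * k') - (q * k') * (p' * k + q' * i) = (p * q' - q * p') * N"
    unfolding \<open>k * k' = N\<close>[symmetric] by (simp add: algebra_simps)
  ultimately show ?thesis
    using C C' by (simp add: Let_def cong_0_iff)
qed

end
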